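(* Let $\Sigma^-_{xx}\in\mathbb{R}^{N\times N}$ be symmetric positive semidefinite, $C\in\mathbb{R}^{m\times N}$, $M_u\in\mathbb{R}^{r\times N}$ and $\gamma_u\in\mathbb{R}$. Consider the optimization problem over $\lambda\in\mathbb{R}^m$, symmetric $Q_u\in\mathbb{R}^{r\times r}$ and arbitrary $K\in\mathbb{R}^{N\times m}$: $$\min_{\lambda\ge 0,\;Q_u\ge 0,\;K}\ \|\lambda\|_1$$ (where $\lambda\ge0$ is componentwise) subject to $$\begin{bmatrix} Q_u & M_u(I-KC)\sqrt{\Sigma^-_{xx}} & M_uK\\ \sqrt{\Sigma^-_{xx}}(I-KC)^TM_u^T & I & 0\\ K^TM_u^T & 0 & \mathcal{S}^{\text{sensor}}\end{bmatrix}\ge 0,\qquad \operatorname{tr}(Q_u)\le\gamma_u,\qquad \mathcal{S}^{\text{sensor}}:=\operatorname{diag}(\lambda).$$ Then the minimum sensing precision satisfying the utility constraint $\operatorname{tr}(\Sigma^+_{x_ux_u})\le\gamma_u$ is given by the solution of this problem. That is, if $(\lambda,Q_u,K)$ is an optimal solution, then sensors with precision vector $\lambda$ satisfy $\operatorname{tr}(\Sigma^+_{x_ux_u})\le\gamma_u$, and $\lambda$ has the smallest $\ell_1$ norm among all precision vectors $\lambda'\ge0$ for which $\operatorname{tr}(\Sigma^+_{x_ux_u})\le\gamma_u$.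
   Context: For symmetric matrices, $A\ge B$ means $A-B$ is positive semidefinite; $\sqrt{\cdot}$ is the symmetric positive semidefinite square root. A fixed time step of an Ensemble/Unscented Kalman filter with linear measurement model $Y=CX+V$ is considered and the time index is suppressed; $\Sigma^-_{xx}$ is the prior state covariance. There is no synthetic noise here: the covariance of $V$ is $\mathcal{R}=\operatorname{diag}(1/\lambda_1,\dots,1/\lambda_m)$, where $\lambda_i$ is the precision (reciprocal of the noise variance) of the $i$-th sensor. The posterior error covariance of the utility variable $X_u=M_uX$ is $$\Sigma^+_{x_ux_u}:=M_u\Sigma^-_{xx}M_u^T-M_u\Sigma^-_{xx}C^T\left(C\Sigma^-_{xx}C^T+\mathcal{R}\right)^{-1}C\Sigma^-_{xx}M_u^T .$$ A precision $\lambda_i=0$ is allowed and means that the $i$-th sensor is not used (infinite noise): $\Sigma^+_{x_ux_u}$ for such $\lambda$ is the limit, as $\varepsilon\downarrow0$, of its value for the precision vector $(\lambda_1+\varepsilon,\dots,\lambda_m+\varepsilon)$. *)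

theory Defs
  imports "HOL-Analysis.Analysis"
begin

text \<open>
  Componentwise order on vectors (\<open>0 \<le> x\<close>) is the library order on \<^typ>\<open>real ^ 'n\<close>. On matrices the
  library order is entrywise, so the Loewner order \<open>A \<ge> 0\<close> is written \<open>psd A\<close>; it includes symmetry.
\<close>

definition psd :: "real ^ 'n ^ 'n \<Rightarrow> bool" where
  "psd A \<longleftrightarrow> transpose A = A \<and> (\<forall>x. 0 \<le> x \<bullet> (A *v x))"

text \<open>Meaningful for \<open>psd A\<close>, where the positive semidefinite square root exists and is unique.\<close>

definition psd_sqrt :: "real ^ 'n ^ 'n \<Rightarrow> real ^ 'n ^ 'n" where
  "psd_sqrt A = (THE B. psd B \<and> B ** B = A)"

definition diag :: "real ^ 'n \<Rightarrow> real ^ 'n ^ 'n" where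
  "diag v = (\<chi> i j. if i = j then v $ i else 0)"

definition l1_norm :: "real ^ 'n \<Rightarrow> real" where
  "l1_norm v = (\<Sum>i\<in>UNIV. \<bar>v $ i\<bar>)"

text \<open>Block matrices: rows and columns are indexed by sum types.\<close>

definition hcat :: "real ^ 'a ^ 'i \<Rightarrow> real ^ 'b ^ 'i \<Rightarrow> real ^ ('a + 'b) ^ 'i" where
  "hcat A B = (\<chi> i j. case j of Inl a \<Rightarrow> A $ i $ a | Inr b \<Rightarrow> B $ i $ b)"

definition vcat :: "real ^ 'j ^ 'a \<Rightarrow> real ^ 'j ^ 'b \<Rightarrow> real ^ 'j ^ ('a + 'b)" where
  "vcat A B = (\<chi> i. case i of Inl a \<Rightarrow> A $ a | Inr b \<Rightarrow> B $ b)"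

definition post_cov_pos ::
  "real ^ 'n ^ 'n \<Rightarrow> real ^ 'n ^ 'm \<Rightarrow> real ^ 'n ^ 'r \<Rightarrow> real ^ 'm \<Rightarrow> real ^ 'r ^ 'r" where
  "post_cov_pos \<Sigma> C M lam =
     M ** \<Sigma> ** transpose M
     - M ** \<Sigma> ** transpose C
         ** matrix_inv (C ** \<Sigma> ** transpose C + diag (\<chi> i. 1 / lam $ i))
         ** C ** \<Sigma> ** transpose M"

text \<open>
  The closed formula is used for positive precisions only: a zero precision (unused sensor, infinite
  noise) must not be fed to \<^const>\<open>post_cov_pos\<close>, because \<open>1 / 0 = 0\<close> would mean a noiseless sensor.
  For \<open>psd \<Sigma>\<close> and \<open>0 \<le> lam\<close> the limit exists: with \<open>D = diag (sqrt (lam + e))\<close> the inverse equals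
  \<open>D (D C \<Sigma> C\<^sup>T D + I)\<^sup>-\<^sup>1 D\<close>, which is continuous in \<open>e \<ge> 0\<close>.
\<close>

definition post_cov ::
  "real ^ 'n ^ 'n \<Rightarrow> real ^ 'n ^ 'm \<Rightarrow> real ^ 'n ^ 'r \<Rightarrow> real ^ 'm \<Rightarrow> real ^ 'r ^ 'r" where
  "post_cov \<Sigma> C M lam =
     (if \<forall>i. 0 < lam $ i then post_cov_pos \<Sigma> C M lam
      else Lim (at_right 0) (\<lambda>e. post_cov_pos \<Sigma> C M (\<chi> i. lam $ i + e)))"

definition lmi_matrix ::
  "real ^ 'n ^ 'n \<Rightarrow> real ^ 'n ^ 'm \<Rightarrow> real ^ 'n ^ 'r \<Rightarrow>
   real ^ 'm \<Rightarrow> real ^ 'r ^ 'r \<Rightarrow> real ^ 'm ^ 'n \<Rightarrow> real ^ ('r + 'n + 'm) ^ ('r + 'n + 'm)" where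
  "lmi_matrix \<Sigma> C M lam Q K =
     vcat (hcat Q
             (hcat (M ** (mat 1 - K ** C) ** psd_sqrt \<Sigma>) (M ** K)))
    (vcat (hcat (psd_sqrt \<Sigma> ** transpose (mat 1 - K ** C) ** transpose M)
             (hcat (mat 1) 0))
          (hcat (transpose K ** transpose M)
             (hcat 0 (diag lam))))"

definition feasible ::
  "real ^ 'n ^ 'n \<Rightarrow> real ^ 'n ^ 'm \<Rightarrow> real ^ 'n ^ 'r \<Rightarrow> real \<Rightarrow>
   (real ^ 'm) \<times> (real ^ 'r ^ 'r) \<times> (real ^ 'm ^ 'n) \<Rightarrow> bool" where
  "feasible \<Sigma> C M \<gamma> = (\<lambda>(lam, Q, K).
     0 \<le> lam \<and> psd Q \<and> psd (lmi_matrix \<Sigma> C M lam Q K) \<and> trace Q \<le> \<gamma>)"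

end

theory Submission
  imports Defs
begin

text \<open>
  Put \<open>L = diag lam\<close> and \<open>T = C \<Sigma> C\<^sup>T\<close>. The posterior covariance is
  \<open>P = M \<Sigma> M\<^sup>T - M \<Sigma> C\<^sup>T L (I + T L)\<^sup>-\<^sup>1 C \<Sigma> M\<^sup>T\<close>, continuous in \<open>lam \<ge> 0\<close>, which covers unused sensors.
  Given \<open>x\<close>, let \<open>w = M\<^sup>T x\<close>, \<open>h = (I + T L)\<^sup>-\<^sup>1 C \<Sigma> w\<close> and \<open>v = w - C\<^sup>T L h\<close>. Then \<open>h = C \<Sigma> v\<close>
  and \<open>x\<^sup>T P x = w\<^sup>T \<Sigma> v = v\<^sup>T \<Sigma> v + h\<^sup>T L h\<close>. Evaluating the quadratic form of the block matrix at
  \<open>(x, - \<surd>\<Sigma> v, - h)\<close> gives \<open>x\<^sup>T Q x - x\<^sup>T P x\<close>, independently of \<open>K\<close>; so \<open>P \<le> Q\<close> for every feasible point.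
  Conversely, for \<open>Q = P\<close> and the Kalman gain \<open>K = \<Sigma> C\<^sup>T L (I + T L)\<^sup>-\<^sup>1\<close> the form at \<open>(x, y, z)\<close> is
  \<open>|\<surd>\<Sigma> v + y|\<^sup>2 + (h + z)\<^sup>T L (h + z)\<close>.
\<close>

section \<open>Matrix preliminaries\<close>

lemma inner_matrix_left:
  fixes A :: "real ^ 'n ^ 'm"
  shows "(A *v x) \<bullet> y = x \<bullet> (transpose A *v y)"
  by (metis dot_lmul_matrix inner_commute transpose_matrix_vector)

lemma transpose_vector_inner:
  fixes A :: "real ^ 'n ^ 'm"
  shows "x \<bullet> (A *v y) = (transpose A *v x) \<bullet> y"
  by (metis inner_matrix_left transpose_transpose)

lemma symmetricI:
  fixes A :: "real ^ 'n ^ 'n"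
  assumes "\<And>x y. x \<bullet> (A *v y) = (A *v x) \<bullet> y"
  shows "transpose A = A"
proof -
  have "transpose A *v x = A *v x" for x
  proof -
    have "y \<bullet> (transpose A *v x) = y \<bullet> (A *v x)" for y
      using assms[of y x] by (simp only: inner_matrix_left)
    then show ?thesis by (metis vector_eq_ldot)
  qed
  then show ?thesis by (simp only: matrix_eq) blast
qed

lemma matrix_diff_rdistrib: "(B - C) ** A = B ** A - (C :: real ^ 'n ^ 'm) ** A"
  by (simp add: matrix_eq matrix_vector_mul_assoc[symmetric] algebra_simps)

lemma diagonal_entry_eq_inner:
  fixes A :: "real ^ 'n ^ 'n"
  shows "A $ i $ i = axis i 1 \<bullet> (A *v axis i 1)"
  by (simp only: matrix_vector_mult_basis column_def inner_axis' vec_lambda_beta)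
    simp

lemma transpose_add: "transpose (A + B) = transpose A + transpose (B :: real ^ 'n ^ 'm)"
  by (simp add: transpose_def vec_eq_iff)

lemma transpose_diff: "transpose (A - B) = transpose A - transpose (B :: real ^ 'n ^ 'm)"
  by (simp add: transpose_def vec_eq_iff)

lemma matrix_diff_ldistrib: "A ** (B - C) = A ** B - A ** (C :: real ^ 'p ^ 'n)"
  by (simp add: matrix_eq matrix_vector_mul_assoc[symmetric] algebra_simps)

lemma matrix_add_rdistrib: "(B + C) ** A = B ** A + (C :: real ^ 'n ^ 'm) ** A"
  by (simp add: matrix_eq matrix_vector_mul_assoc[symmetric] algebra_simps)

section \<open>Inverses of square matrices\<close>

lemma matrix_inv_left_inverse:
  fixes A :: "real ^ 'n ^ 'n"
  assumes "invertible A"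
  shows "matrix_inv A ** A = mat 1"
  using assms unfolding invertible_def matrix_inv_def by (metis (mono_tags, lifting) someI_ex)

lemma matrix_inv_right_inverse:
  fixes A :: "real ^ 'n ^ 'n"
  assumes "invertible A"
  shows "A ** matrix_inv A = mat 1"
  using assms unfolding invertible_def matrix_inv_def by (metis (mono_tags, lifting) someI_ex)

lemma matrix_inv_unique_right:
  fixes A B :: "real ^ 'n ^ 'n"
  assumes "A ** B = mat 1"
  shows "matrix_inv A = B"
proof -
  have "invertible A" using assms invertible_right_inverse by blast
  then have "matrix_inv A ** (A ** B) = B"
    by (simp add: matrix_mul_assoc matrix_inv_left_inverse)
  then show ?thesis by (simp add: assms)
qed

section \<open>Continuity of product, determinant and inverse\<close>

lemma tendsto_matrix_mult:
  fixes f :: "'a \<Rightarrow> real ^ 'n ^ 'm" and g :: "'a \<Rightarrow> real ^ 'p ^ 'n"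
  assumes "(f \<longlongrightarrow> A) F" "(g \<longlongrightarrow> B) F"
  shows "((\<lambda>x. f x ** g x) \<longlongrightarrow> A ** B) F"
  unfolding matrix_matrix_mult_def
  by (intro vec_tendstoI) (simp, intro tendsto_intros tendsto_vec_nth assms)

lemma tendsto_det:
  fixes f :: "'a \<Rightarrow> real ^ 'n ^ 'n"
  assumes "(f \<longlongrightarrow> A) F"
  shows "((\<lambda>x. det (f x)) \<longlongrightarrow> det A) F"
  unfolding det_def by (intro tendsto_intros tendsto_vec_nth assms)

text \<open>Cramer's rule for the system whose solution is column \<open>l\<close> of the inverse.
  Each entry becomes a quotient of determinants, which is what makes inversion continuous.\<close>

lemma matrix_inv_nth:
  fixes A :: "real ^ 'n ^ 'n"
  assumes "det A \<noteq> 0"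
  shows "matrix_inv A $ k $ l =
    det (\<chi> i j. if j = k then axis l 1 $ i else A $ i $ j) / det A"
proof -
  have inv: "invertible A" using assms invertible_det_nz by blast
  have "A *v (matrix_inv A *v axis l 1) = axis l 1"
    by (simp add: matrix_vector_mul_assoc matrix_inv_right_inverse[OF inv])
  then have "(matrix_inv A *v axis l 1) $ k =
      det (\<chi> i j. if j = k then axis l 1 $ i else A $ i $ j) / det A"
    using cramer[OF assms] by (simp add: vec_eq_iff)
  then show ?thesis by (simp add: matrix_vector_mult_basis column_def)
qed

lemma tendsto_matrix_inv:
  fixes f :: "'a \<Rightarrow> real ^ 'n ^ 'n"
  assumes f: "(f \<longlongrightarrow> A) F" and A: "invertible A"
  shows "((\<lambda>x. matrix_inv (f x)) \<longlongrightarrow> matrix_inv A) F"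
proof (intro vec_tendstoI)
  fix k l
  have nz: "det A \<noteq> 0" using A invertible_det_nz by blast
  let ?N = "\<lambda>B :: real ^ 'n ^ 'n. (\<chi> i j. if j = k then axis l 1 $ i else B $ i $ j) :: real ^ 'n ^ 'n"
  have "((\<lambda>x. ?N (f x)) \<longlongrightarrow> ?N A) F"
    by (intro vec_tendstoI) (auto intro!: tendsto_vec_nth f)
  then have "((\<lambda>x. det (?N (f x)) / det (f x)) \<longlongrightarrow> det (?N A) / det A) F"
    by (intro tendsto_divide tendsto_det f nz)
  moreover have "\<forall>\<^sub>F x in F. det (f x) \<noteq> 0"
    using tendsto_det[OF f] nz by (rule tendsto_imp_eventually_ne)
  then have "\<forall>\<^sub>F x in F. det (?N (f x)) / det (f x) = matrix_inv (f x) $ k $ l"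
    by (rule eventually_mono) (simp add: matrix_inv_nth)
  ultimately show "((\<lambda>x. matrix_inv (f x) $ k $ l) \<longlongrightarrow> matrix_inv A $ k $ l) F"
    unfolding matrix_inv_nth[OF nz] by (rule Lim_transform_eventually)
qed

section \<open>Positive semidefinite matrices and square roots\<close>

lemma psd_nonneg: "psd A \<Longrightarrow> 0 \<le> x \<bullet> (A *v x)"
  by (simp add: psd_def)

lemma psd_symmetric: "psd A \<Longrightarrow> transpose A = A"
  by (simp add: psd_def)

lemma psd_inner: "psd A \<Longrightarrow> (A *v x) \<bullet> y = x \<bullet> (A *v y)"
  by (simp only: inner_matrix_left psd_symmetric)

lemma psdI:
  assumes "\<And>x y. x \<bullet> (A *v y) = (A *v x) \<bullet> y" "\<And>x. 0 \<le> x \<bullet> (A *v x)"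
  shows "psd A"
  using symmetricI[of A] assms unfolding psd_def by blast

text \<open>If \<open>A *v x\<close> were nonzero, moving from \<open>x\<close> a little against
  that direction would make the quadratic form negative.\<close>

lemma psd_kernel:
  assumes A: "psd A" and x: "x \<bullet> (A *v x) = 0"
  shows "A *v x = 0"
proof (rule ccontr)
  assume nz: "A *v x \<noteq> 0"
  define y where "y = A *v x"
  define b where "b = y \<bullet> y"
  define c where "c = y \<bullet> (A *v y)"
  \<comment> \<open>The form along \<open>x + t *\<^sub>R y\<close> is
    \<open>2 * t * b + t * t * c\<close>. Its minimiser would be \<open>- b / c\<close>; the
    denominator \<open>c + 1\<close> also covers \<open>c = 0\<close>.\<close>
  define t where "t = - b / (c + 1)"
  have b: "b > 0" using nz by (simp add: b_def y_def)
  have c: "c \<ge> 0" unfolding c_def by (rule psd_nonneg[OF A])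
  have "0 \<le> (x + t *\<^sub>R y) \<bullet> (A *v (x + t *\<^sub>R y))" by (rule psd_nonneg[OF A])
  also have "\<dots> = 2 * t * b + t * t * c"
    using x psd_inner[OF A, of x y]
    by (simp add: algebra_simps inner_add_left inner_add_right b_def c_def y_def[symmetric])
  also have "\<dots> = - (b * b * (c + 2)) / ((c + 1) * (c + 1))"
    using c by (simp add: t_def divide_simps) (simp add: algebra_simps)
  also have "\<dots> < 0" using b c by (simp add: divide_simps mult_pos_pos)
  finally show False by simp
qed

lemma trace_psd_nonneg:
  assumes "\<And>x. 0 \<le> x \<bullet> (A *v x)"
  shows "0 \<le> trace (A :: real ^ 'n ^ 'n)"
proof -
  have "0 \<le> A $ i $ i" for i
    using assms[of "axis i 1"] by (simp only: diagonal_entry_eq_inner)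
  then show ?thesis unfolding trace_def by (rule sum_nonneg)
qed

text \<open>The diagonal entries are nonnegative with sum zero, so the form vanishes at every basis
  vector, and \<open>psd_kernel\<close> kills every column.\<close>

lemma trace_psd_eq_0:
  assumes A: "psd A" and 0: "trace A = 0"
  shows "A = 0"
proof -
  have diag: "A $ i $ i = axis i 1 \<bullet> (A *v axis i 1)" for i
    by (rule diagonal_entry_eq_inner)
  then have "\<And>i. A $ i $ i \<ge> 0" using psd_nonneg[OF A] by metis
  then have "\<And>i. A $ i $ i = 0"
    using 0 unfolding trace_def by (simp add: sum_nonneg_eq_0_iff)
  then have "A *v axis i 1 = 0" for i
    using diag psd_kernel[OF A] by metis
  then show ?thesis
    by (simp add: matrix_vector_mult_basis column_def vec_eq_iff)
qed

lemma psd_congruence: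
  assumes "psd A"
  shows "psd (transpose B ** A ** B)"
proof (rule psdI)
  have *: "x \<bullet> ((transpose B ** A ** B) *v y) = (B *v x) \<bullet> (A *v (B *v y))" for x y
    by (simp only: inner_matrix_left matrix_vector_mul_assoc matrix_mul_assoc)
  show "x \<bullet> ((transpose B ** A ** B) *v y) = ((transpose B ** A ** B) *v x) \<bullet> y" for x y
    using *[of x y] *[of y x] psd_inner[OF assms, of "B *v x" "B *v y"]
    by (metis inner_commute)
  show "0 \<le> x \<bullet> ((transpose B ** A ** B) *v x)" for x
    unfolding * by (rule psd_nonneg[OF assms])
qed

section \<open>Square roots: uniqueness by traces, existence by deflation\<close>

lemma symmetric_square_eq_0:
  fixes D :: "real ^ 'n ^ 'n"
  assumes "transpose D = D" "D ** D = 0"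
  shows "D = 0"
proof -
  have "D *v x = 0" for x
  proof -
    have "(D *v x) \<bullet> (D *v x) = x \<bullet> ((D ** D) *v x)"
      by (metis assms(1) inner_matrix_left matrix_vector_mul_assoc)
    then show ?thesis using assms(2) by simp
  qed
  then show ?thesis by (simp add: matrix_eq)
qed

text \<open>With \<open>D = A - B\<close>, the equation \<open>A\<^sup>2 = B\<^sup>2\<close> reads \<open>A D + D B = 0\<close>; multiplying by \<open>D\<close> and taking
  traces gives \<open>tr (D A D) + tr (D B D) = 0\<close>, so both psd matrices vanish.\<close>

lemma psd_sqrt_unique:
  assumes A: "psd A" and B: "psd B" and eq: "A ** A = B ** B"
  shows "A = B"
proof -
  define D where "D = A - B"
  have Ds: "transpose D = D" by (simp add: D_def transpose_diff psd_symmetric A B)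
  have "A ** D + D ** B = 0"
    by (simp add: D_def matrix_diff_ldistrib matrix_diff_rdistrib eq)
  then have "D ** (A ** D) + D ** (D ** B) = 0"
    by (metis matrix_add_ldistrib times0_right)
  then have "trace (D ** (A ** D)) + trace (D ** (D ** B)) = 0"
    by (metis mat_0 trace_0 trace_add)
  moreover have "trace (D ** (D ** B)) = trace ((D ** B) ** D)"
    by (rule trace_mul_sym)
  moreover have pA: "psd (D ** A ** D)" and pB: "psd (D ** B ** D)"
    using psd_congruence[of _ D] A B Ds by metis+
  moreover have "0 \<le> trace (D ** A ** D)" "0 \<le> trace (D ** B ** D)"
    using trace_psd_nonneg psd_nonneg pA pB by blast+
  ultimately have "trace (D ** A ** D) = 0" "trace (D ** B ** D) = 0"
    by (simp_all add: matrix_mul_assoc)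
  then have 0: "D ** A ** D = 0" "D ** B ** D = 0"
    using trace_psd_eq_0 pA pB by blast+
  \<comment> \<open>The form of \<open>E\<close> vanishes on the range of \<open>D\<close>. Applied
    to \<open>A\<close> and to \<open>B\<close>, this gives
    \<open>D ** D = A ** D - B ** D = 0\<close>.\<close>
  have kernel: "E ** D = 0" if E: "psd E" and 0: "D ** E ** D = 0" for E
  proof -
    have "E *v (D *v x) = 0" for x
    proof (rule psd_kernel[OF E])
      have "(D *v x) \<bullet> (E *v (D *v x)) = x \<bullet> ((D ** E ** D) *v x)"
        by (simp only: inner_matrix_left Ds matrix_vector_mul_assoc matrix_mul_assoc)
      then show "(D *v x) \<bullet> (E *v (D *v x)) = 0" by (simp add: 0)
    qed
    then show ?thesis by (simp add: matrix_eq matrix_vector_mul_assoc)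
  qed
  have "D ** D = A ** D - B ** D" by (simp add: D_def matrix_diff_rdistrib)
  then have "D ** D = 0" using kernel A B 0 by simp
  then show ?thesis using symmetric_square_eq_0[OF Ds] by (simp add: D_def)
qed

text \<open>A maximiser \<open>v\<close> of the form on the unit sphere works: with \<open>l\<close>
  the maximum, \<open>l *\<^sub>R mat 1 - A\<close> is psd and its form vanishes at
  \<open>v\<close>, so \<open>v\<close> lies in its kernel. If \<open>l\<close> were not positive,
  the form of \<open>A\<close> would vanish identically, forcing \<open>A = 0\<close>.\<close>

lemma psd_eigenvector:
  fixes A :: "real ^ 'n ^ 'n"
  assumes A: "psd A" and nz: "A \<noteq> 0"
  obtains v l where "norm v = 1" "l > 0" "A *v v = l *\<^sub>R v"
proof -
  have "\<exists>v\<in>sphere 0 1. \<forall>y\<in>sphere 0 1. y \<bullet> (A *v y) \<le> v \<bullet> (A *v v)"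
  proof (rule continuous_attains_sup)
    show "sphere (0 :: real ^ 'n) 1 \<noteq> {}" by simp
    show "continuous_on (sphere 0 1) (\<lambda>x. x \<bullet> (A *v x))"
      by (intro continuous_intros matrix_vector_mult_linear_continuous_on)
  qed simp
  then obtain v where v: "norm v = 1"
    and sup: "\<And>y. norm y = 1 \<Longrightarrow> y \<bullet> (A *v y) \<le> v \<bullet> (A *v v)"
    by auto
  define l where "l = v \<bullet> (A *v v)"
  have le: "x \<bullet> (A *v x) \<le> l * (x \<bullet> x)" for x
  proof (cases "x = 0")
    case False
    define y where "y = (1 / norm x) *\<^sub>R x"
    have x: "x = norm x *\<^sub>R y" using False by (simp add: y_def)
    have "y \<bullet> (A *v y) \<le> l" unfolding l_def by (rule sup) (simp add: y_def False)
    then have "(norm x * norm x) * (y \<bullet> (A *v y)) \<le> (norm x * norm x) * l"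
      by (intro mult_left_mono) auto
    moreover have "x \<bullet> (A *v x) = (norm x * norm x) * (y \<bullet> (A *v y))"
      by (subst (1 2) x) (simp add: matrix_vector_mult_scaleR)
    moreover have "x \<bullet> x = norm x * norm x"
      by (metis power2_eq_square power2_norm_eq_inner)
    ultimately show ?thesis by (simp add: mult.commute)
  qed simp
  let ?G = "l *\<^sub>R mat 1 - A"
  have G: "?G *v x = l *\<^sub>R x - A *v x" for x
    by (simp add: matrix_vector_mult_diff_rdistrib scaleR_matrix_vector_assoc[symmetric])
  have "psd ?G"
  proof (rule psdI)
    show "x \<bullet> (?G *v y) = (?G *v x) \<bullet> y" for x y
      using psd_inner[OF A, of x y] by (simp add: G inner_diff_left inner_diff_right)
    show "0 \<le> x \<bullet> (?G *v x)" for x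
      using le[of x] by (simp add: G inner_diff_right)
  qed
  moreover have "v \<bullet> v = 1" using v by (metis norm_eq_1)
  then have "v \<bullet> (?G *v v) = 0"
    by (simp add: G inner_diff_right l_def[symmetric])
  ultimately have "?G *v v = 0" by (rule psd_kernel)
  then have "A *v v = l *\<^sub>R v" by (simp add: G)
  moreover have "l > 0"
  proof (rule ccontr)
    assume "\<not> l > 0"
    have "A *v x = 0" for x
    proof (rule psd_kernel[OF A])
      have "l * (x \<bullet> x) \<le> 0" using \<open>\<not> l > 0\<close> by (simp add: mult_nonpos_nonneg)
      then show "x \<bullet> (A *v x) = 0" using le[of x] psd_nonneg[OF A, of x] by linarith
    qed
    then show False using nz by (simp add: matrix_eq)
  qed
  ultimately show ?thesis using v that by blast
qed

text \<open>Deflation: subtracting \<open>l v v\<^sup>T\<close> for a unit eigenvector \<open>v\<close> enlarges the kernel.\<close>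

lemma psd_sqrt_exists:
  fixes A :: "real ^ 'n ^ 'n"
  assumes "psd A"
  shows "\<exists>B. psd B \<and> B ** B = A"
  using assms
\<comment> \<open>The induction is on the rank of \<open>A\<close>, expressed as the codimension of
  its kernel.\<close>
proof (induction "CARD('n) - dim {x. A *v x = 0}" arbitrary: A rule: less_induct)
  case less
  note A = less.prems
  show ?case
  proof (cases "A = 0")
    case True
    have "psd (0 :: real ^ 'n ^ 'n)" by (rule psdI) simp_all
    then show ?thesis using True by (intro exI[of _ 0]) simp
  next
    case False
    obtain v l where v: "norm v = 1" and l: "l > 0" and Av: "A *v v = l *\<^sub>R v"
      using psd_eigenvector[OF A False] .
    have vv: "v \<bullet> v = 1" using v by (metis norm_eq_1)
    \<comment> \<open>\<open>P\<close> is the orthogonal projection onto the line through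
      \<open>v\<close>.\<close>
    define P :: "real ^ 'n ^ 'n" where "P = (\<chi> i j. v $ i * v $ j)"
    have P: "P *v x = (v \<bullet> x) *\<^sub>R v" for x
      by (simp add: P_def matrix_vector_mult_def vec_eq_iff inner_vec_def sum_distrib_left mult_ac)
    define A' where "A' = A - l *\<^sub>R P"
    have A': "A' *v x = A *v x - (l * (v \<bullet> x)) *\<^sub>R v" for x
      by (simp add: A'_def matrix_vector_mult_diff_rdistrib scaleR_matrix_vector_assoc[symmetric] P)
    have vA: "v \<bullet> (A *v x) = l * (v \<bullet> x)" for x
      using psd_inner[OF A, of v x] Av by simp
    have psd': "psd A'"
    proof (rule psdI)
      show "x \<bullet> (A' *v y) = (A' *v x) \<bullet> y" for x y
        using psd_inner[OF A, of x y]
        by (simp add: A' inner_diff_left inner_diff_right inner_commute)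
      fix x
      \<comment> \<open>On the component of \<open>x\<close> orthogonal to \<open>v\<close>, the
        form of \<open>A\<close> equals the form of \<open>A'\<close> at \<open>x\<close>.\<close>
      define y where "y = x - (v \<bullet> x) *\<^sub>R v"
      have "0 \<le> y \<bullet> (A *v y)" by (rule psd_nonneg[OF A])
      also have "\<dots> = x \<bullet> (A' *v x)"
        by (simp add: y_def A' matrix_vector_mult_diff_distrib matrix_vector_mult_scaleR
            inner_diff_left inner_diff_right vA Av vv inner_commute[of x v])
      finally show "0 \<le> x \<bullet> (A' *v x)" .
    qed
    have A'v: "A' *v v = 0" by (simp add: A' Av vv)
    have ker: "{x. A *v x = 0} \<subset> {x. A' *v x = 0}"
    proof
      show "{x. A *v x = 0} \<subseteq> {x. A' *v x = 0}"
      proof clarify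
        fix x assume x: "A *v x = 0"
        then have "v \<bullet> x = 0" using vA[of x] l by simp
        then show "A' *v x = 0" by (simp add: A' x)
      qed
      have "v \<notin> {x. A *v x = 0}" using Av l v by auto
      then show "{x. A *v x = 0} \<noteq> {x. A' *v x = 0}" using A'v by blast
    qed
    have sub: "span {x. E *v x = 0} = {x. E *v x = 0}" for E :: "real ^ 'n ^ 'n"
      by (rule span_eq_iff[THEN iffD2])
        (auto simp: subspace_def matrix_vector_right_distrib matrix_vector_mult_scaleR)
    have "dim {x. A *v x = 0} < dim {x. A' *v x = 0}"
      using ker by (intro dim_psubset) (simp only: sub)
    moreover have "dim {x. A' *v x = 0} \<le> CARD('n)"
      using dim_subset_UNIV[of "{x. A' *v x = 0}"] by simp
    ultimately have "CARD('n) - dim {x. A' *v x = 0} < CARD('n) - dim {x. A *v x = 0}"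
      by linarith
    then obtain B' where B': "psd B'" "B' ** B' = A'"
      using less.hyps psd' by blast
    \<comment> \<open>Since \<open>B'\<close> annihilates \<open>v\<close> and its range is
      orthogonal to \<open>v\<close>, the cross terms in the square of
      \<open>B' + sqrt l *\<^sub>R P\<close> vanish.\<close>
    have "(B' *v v) \<bullet> (B' *v v) = v \<bullet> (A' *v v)"
      using B' by (metis psd_inner matrix_vector_mul_assoc)
    then have B'v: "B' *v v = 0" by (simp add: A'v)
    have vB': "v \<bullet> (B' *v x) = 0" for x
      using psd_inner[OF B'(1), of v x] B'v by simp
    define B where "B = B' + sqrt l *\<^sub>R P"
    have B: "B *v x = B' *v x + (sqrt l * (v \<bullet> x)) *\<^sub>R v" for x
      by (simp add: B_def matrix_vector_mult_add_rdistrib scaleR_matrix_vector_assoc[symmetric] P)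
    have "psd B"
    proof (rule psdI)
      show "x \<bullet> (B *v y) = (B *v x) \<bullet> y" for x y
        using psd_inner[OF B'(1), of x y]
        by (simp add: B inner_add_left inner_add_right inner_commute)
      show "0 \<le> x \<bullet> (B *v x)" for x
        using psd_nonneg[OF B'(1), of x] l
        by (simp add: B inner_add_right inner_commute[of x v] mult.assoc)
    qed
    moreover have "B ** B = A"
    proof -
      have "B *v (B *v x) = A *v x" for x
      proof -
        have "B' *v (B' *v x) = A *v x - (l * (v \<bullet> x)) *\<^sub>R v"
          using A'[of x] B'(2) by (simp add: matrix_vector_mul_assoc)
        moreover have "sqrt l * (sqrt l * (v \<bullet> x)) = l * (v \<bullet> x)"
          using l by (simp add: mult.assoc[symmetric])
        ultimately show ?thesis
          by (simp add: B matrix_vector_right_distrib matrix_vector_mult_scaleR B'v vB' vv inner_add_right)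
      qed
      then show ?thesis by (simp add: matrix_eq matrix_vector_mul_assoc)
    qed
    ultimately show ?thesis by blast
  qed
qed

lemma psd_sqrt:
  assumes "psd A"
  shows "psd (psd_sqrt A)" "psd_sqrt A ** psd_sqrt A = A"
proof -
  have "\<exists>!B. psd B \<and> B ** B = A"
    using psd_sqrt_exists[OF assms] psd_sqrt_unique by metis
  then have "psd (psd_sqrt A) \<and> psd_sqrt A ** psd_sqrt A = A"
    unfolding psd_sqrt_def by (rule theI')
  then show "psd (psd_sqrt A)" "psd_sqrt A ** psd_sqrt A = A" by auto
qed

section \<open>Block matrices\<close>

definition vtop :: "real ^ ('a::finite + 'b::finite) \<Rightarrow> real ^ 'a" where
  "vtop u = (\<chi> i. u $ Inl i)"

definition vbot :: "real ^ ('a::finite + 'b::finite) \<Rightarrow> real ^ 'b" where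
  "vbot u = (\<chi> i. u $ Inr i)"

definition vjoin :: "real ^ 'a \<Rightarrow> real ^ 'b \<Rightarrow> real ^ ('a::finite + 'b::finite)" where
  "vjoin x y = (\<chi> k. case k of Inl i \<Rightarrow> x $ i | Inr j \<Rightarrow> y $ j)"

lemma vtop_vjoin [simp]: "vtop (vjoin x y) = x"
  and vbot_vjoin [simp]: "vbot (vjoin x y) = y"
  by (simp_all add: vtop_def vbot_def vjoin_def vec_eq_iff)

lemma vjoin_vtop_vbot: "vjoin (vtop u) (vbot u) = u"
  by (simp add: vjoin_def vtop_def vbot_def vec_eq_iff split: sum.split)

lemma sum_UNIV_Plus:
  "(\<Sum>k\<in>UNIV. f (k :: 'a::finite + 'b::finite)) = (\<Sum>i\<in>UNIV. f (Inl i)) + (\<Sum>j\<in>UNIV. f (Inr j))"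
  by (subst UNIV_Plus_UNIV[symmetric], subst sum.Plus) simp_all

lemma inner_vtop_vbot: "u \<bullet> v = vtop u \<bullet> vtop v + vbot u \<bullet> vbot v"
  by (simp add: inner_vec_def sum_UNIV_Plus vtop_def vbot_def)

lemma hcat_mult: "hcat A B *v u = A *v vtop u + B *v vbot u"
  by (simp add: vec_eq_iff matrix_vector_mult_def hcat_def sum_UNIV_Plus vtop_def vbot_def)

lemma vtop_vcat_mult: "vtop (vcat A B *v u) = A *v u"
  and vbot_vcat_mult: "vbot (vcat A B *v u) = B *v u"
  by (simp_all add: vec_eq_iff matrix_vector_mult_def vcat_def vtop_def vbot_def)

section \<open>The bilinear and quadratic forms of the block matrix\<close>

lemma inner_lmi_matrix:
  fixes \<Sigma> :: "real ^ 'n ^ 'n" and C :: "real ^ 'n ^ 'm" and M :: "real ^ 'n ^ 'r"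
    and K :: "real ^ 'm ^ 'n"
  assumes "psd \<Sigma>"
  defines "S \<equiv> psd_sqrt \<Sigma>"
  defines "V \<equiv> \<lambda>x. transpose M *v x - transpose C *v (transpose K *v (transpose M *v x))"
  shows "vjoin x (vjoin y z) \<bullet> (lmi_matrix \<Sigma> C M lam Q K *v vjoin x' (vjoin y' z')) =
    x \<bullet> (Q *v x') + (S *v V x) \<bullet> y' + y \<bullet> (S *v V x')
    + (transpose K *v (transpose M *v x)) \<bullet> z' + z \<bullet> (transpose K *v (transpose M *v x'))
    + y \<bullet> y' + z \<bullet> (diag lam *v z')"
proof -
  have S: "transpose S = S" unfolding S_def by (rule psd_symmetric[OF psd_sqrt(1)[OF assms(1)]])
  have V: "transpose (mat 1 - K ** C) *v (transpose M *v x) = V x" for x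
    by (simp only: V_def transpose_diff matrix_transpose_mul transpose_mat
        matrix_vector_mult_diff_rdistrib matrix_vector_mul_lid matrix_vector_mul_assoc[symmetric])
  have SV: "(S ** transpose (mat 1 - K ** C) ** transpose M) *v x = S *v V x" for x
    by (simp only: V[symmetric] matrix_vector_mul_assoc matrix_mul_assoc)
  have "transpose (M ** (mat 1 - K ** C) ** S) *v x = S *v V x" for x
    by (simp only: V[symmetric] matrix_transpose_mul S matrix_vector_mul_assoc matrix_mul_assoc)
  then have "x \<bullet> ((M ** (mat 1 - K ** C) ** S) *v y') = (S *v V x) \<bullet> y'"
    by (simp only: transpose_vector_inner)
  moreover have "x \<bullet> ((M ** K) *v z') = (transpose K *v (transpose M *v x)) \<bullet> z'"
    by (simp only: transpose_vector_inner matrix_transpose_mul matrix_vector_mul_assoc)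
  moreover have "(transpose K ** transpose M) *v x' = transpose K *v (transpose M *v x')"
    by (simp only: matrix_vector_mul_assoc)
  ultimately show ?thesis
    unfolding lmi_matrix_def S_def[symmetric]
    by (simp add: inner_vtop_vbot vtop_vcat_mult vbot_vcat_mult hcat_mult SV inner_add_right
        del: transpose_matrix_vector)
qed

text \<open>The off-diagonal blocks come in transposed pairs and the other diagonal blocks are
  symmetric, so symmetry of \<open>Q\<close> makes the whole matrix symmetric. What remains is the
  sign of its form, with \<open>V x\<close> standing for the transpose of
  \<open>M ** (mat 1 - K ** C)\<close> applied to \<open>x\<close>.\<close>

lemma psd_lmi_matrix_iff:
  fixes \<Sigma> :: "real ^ 'n ^ 'n" and C :: "real ^ 'n ^ 'm" and M :: "real ^ 'n ^ 'r"
    and K :: "real ^ 'm ^ 'n"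
  assumes "psd \<Sigma>"
  defines "S \<equiv> psd_sqrt \<Sigma>"
  defines "V \<equiv> \<lambda>x. transpose M *v x - transpose C *v (transpose K *v (transpose M *v x))"
  assumes Q: "transpose Q = Q"
  shows "psd (lmi_matrix \<Sigma> C M lam Q K) \<longleftrightarrow>
    (\<forall>x y z. 0 \<le> x \<bullet> (Q *v x) + 2 * ((S *v V x) \<bullet> y)
      + 2 * ((transpose K *v (transpose M *v x)) \<bullet> z) + y \<bullet> y + z \<bullet> (diag lam *v z))"
    (is "psd ?L \<longleftrightarrow> (\<forall>x y z. 0 \<le> ?q x y z)")
proof -
  note form = inner_lmi_matrix[OF assms(1), of _ _ _ C M lam Q K, folded S_def]
  have q: "vjoin x (vjoin y z) \<bullet> (?L *v vjoin x (vjoin y z)) = ?q x y z" for x y z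
    by (simp add: form V_def inner_commute del: transpose_matrix_vector)
  show ?thesis
  proof
    assume "psd ?L"
    then show "\<forall>x y z. 0 \<le> ?q x y z" using psd_nonneg q by metis
  next
    assume nonneg: "\<forall>x y z. 0 \<le> ?q x y z"
    show "psd ?L"
    proof (rule psdI)
      fix u v :: "real ^ ('r + 'n + 'm)"
      obtain x y z where u: "u = vjoin x (vjoin y z)" using vjoin_vtop_vbot by metis
      obtain x' y' z' where v: "v = vjoin x' (vjoin y' z')" using vjoin_vtop_vbot by metis
      have "x \<bullet> (Q *v x') = x' \<bullet> (Q *v x)"
        by (metis Q transpose_vector_inner inner_commute)
      moreover have "z \<bullet> (diag lam *v z') = z' \<bullet> (diag lam *v z)"
        by (simp add: diag_def inner_vec_def matrix_vector_mult_def if_distrib if_distribR cong: if_cong)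
          (rule sum.cong, simp_all)
      ultimately have "u \<bullet> (?L *v v) = v \<bullet> (?L *v u)"
        by (simp add: u v form V_def inner_commute del: transpose_matrix_vector)
      then show "u \<bullet> (?L *v v) = (?L *v u) \<bullet> v" by (simp add: inner_commute)
      show "0 \<le> u \<bullet> (?L *v u)" unfolding u q using nonneg by blast
    qed
  qed
qed

section \<open>The posterior covariance in information form\<close>

lemma diag_mult: "diag l *v x = (\<chi> i. l $ i * x $ i)"
  by (simp add: diag_def vec_eq_iff matrix_vector_mult_def if_distrib if_distribR cong: if_cong)

lemma psd_diag: "0 \<le> l \<Longrightarrow> psd (diag l)"
proof (rule psdI)
  show "x \<bullet> (diag l *v y) = (diag l *v x) \<bullet> y" for x y
    by (simp add: diag_mult inner_vec_def mult_ac)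
  show "0 \<le> x \<bullet> (diag l *v x)" if "0 \<le> l" for x
    using that by (auto simp: diag_mult inner_vec_def less_eq_vec_def mult.left_commute intro!: sum_nonneg)
qed

text \<open>For positive \<open>l\<close> this is \<open>(T + diag(1/l))\<^sup>-\<^sup>1\<close>, written so that zero entries of \<open>l\<close> are harmless.\<close>

definition sensor_weight :: "real ^ 'm ^ 'm \<Rightarrow> real ^ 'm \<Rightarrow> real ^ 'm ^ 'm" where
  "sensor_weight T l = diag l ** matrix_inv (mat 1 + T ** diag l)"

text \<open>Write \<open>L = diag l\<close>. Pairing \<open>x + T L x = 0\<close> with
  \<open>L x\<close> gives two nonnegative terms with sum zero, hence \<open>L x = 0\<close> and
  then \<open>x = 0\<close>.\<close>

lemma invertible_sensor:
  assumes T: "psd T" and l: "0 \<le> l"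
  shows "invertible (mat 1 + T ** diag l)"
proof -
  have "x = 0" if 0: "(mat 1 + T ** diag l) *v x = 0" for x
  proof -
    let ?y = "diag l *v x"
    have x: "x + T *v ?y = 0"
      using 0 by (simp add: matrix_vector_mult_add_rdistrib matrix_vector_mul_assoc)
    then have "?y \<bullet> x + ?y \<bullet> (T *v ?y) = 0" by (metis inner_add_right inner_zero_right)
    then have "x \<bullet> ?y = 0"
      using psd_nonneg[OF T, of ?y] psd_nonneg[OF psd_diag[OF l], of x] by (simp add: inner_commute)
    then have "?y = 0" by (rule psd_kernel[OF psd_diag[OF l]])
    then show "x = 0" using x by simp
  qed
  then show ?thesis by (simp add: invertible_left_inverse matrix_left_invertible_ker)
qed

text \<open>For positive \<open>l\<close>, multiplying \<open>T + diag(1/l)\<close> by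
  \<open>diag l\<close> from the right gives \<open>mat 1 + T ** diag l\<close>, which the second
  factor of \<open>sensor_weight\<close> inverts.\<close>

lemma sensor_weight_eq_inverse:
  assumes T: "psd T" and l: "\<And>i. 0 < l $ i"
  shows "matrix_inv (T + diag (\<chi> i. 1 / l $ i)) = sensor_weight T l"
proof (rule matrix_inv_unique_right)
  have "0 \<le> l" using l by (simp add: less_eq_vec_def less_imp_le)
  note inv = matrix_inv_right_inverse[OF invertible_sensor[OF T this]]
  have "l $ i \<noteq> 0" for i using l[of i] by simp
  then have "diag (\<chi> i. 1 / l $ i) ** diag l = mat 1"
    by (simp add: matrix_eq matrix_vector_mul_assoc[symmetric] diag_mult vec_eq_iff)
  then have "(T + diag (\<chi> i. 1 / l $ i)) ** diag l = mat 1 + T ** diag l"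
    by (simp add: matrix_add_rdistrib add.commute)
  then show "(T + diag (\<chi> i. 1 / l $ i)) ** sensor_weight T l = mat 1"
    by (simp add: sensor_weight_def matrix_mul_assoc inv)
qed

text \<open>A push-through argument: \<open>(1 + L T) L = L (1 + T L)\<close>, and inverting the
  outer factors moves the inverse from one side of \<open>L\<close> to the other.\<close>

lemma transpose_sensor_weight:
  assumes T: "psd T" and l: "0 \<le> l"
  shows "transpose (sensor_weight T l) = sensor_weight T l"
proof -
  let ?L = "diag l" and ?J = "matrix_inv (mat 1 + T ** diag l)"
  note J = matrix_inv_right_inverse[OF invertible_sensor[OF T l]]
  have L: "transpose ?L = ?L" by (rule psd_symmetric[OF psd_diag[OF l]])
  have "transpose ((mat 1 + T ** ?L) ** ?J) = mat 1" by (simp only: J transpose_mat)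
  then have J': "transpose ?J ** (mat 1 + ?L ** T) = mat 1"
    by (simp only: matrix_transpose_mul transpose_add transpose_mat L psd_symmetric[OF T])
  have "?L ** ?J = (transpose ?J ** (mat 1 + ?L ** T)) ** ?L ** ?J" by (simp add: J')
  also have "\<dots> = transpose ?J ** ?L ** ((mat 1 + T ** ?L) ** ?J)"
    by (simp add: matrix_add_ldistrib matrix_add_rdistrib matrix_mul_assoc)
  also have "\<dots> = transpose ?J ** ?L" by (simp add: J)
  finally show ?thesis by (simp only: sensor_weight_def matrix_transpose_mul transpose_transpose L)
qed

lemma tendsto_sensor_weight:
  assumes T: "psd T" and l: "0 \<le> l"
  shows "((\<lambda>e. sensor_weight T (\<chi> i. l $ i + e)) \<longlongrightarrow> sensor_weight T l) (at_right 0)"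
proof -
  have "((\<lambda>e. diag (\<chi> i. l $ i + e) $ i $ j) \<longlongrightarrow> diag l $ i $ j) (at_right 0)" for i j
    by (cases "i = j") (auto simp: diag_def intro!: tendsto_eq_intros)
  then have "((\<lambda>e. diag (\<chi> i. l $ i + e)) \<longlongrightarrow> diag l) (at_right 0)"
    by (intro vec_tendstoI)
  then show ?thesis
    unfolding sensor_weight_def
    by (intro tendsto_matrix_mult tendsto_matrix_inv tendsto_add tendsto_const invertible_sensor T l)
qed

definition info_post_cov ::
  "real ^ 'n ^ 'n \<Rightarrow> real ^ 'n ^ 'm \<Rightarrow> real ^ 'n ^ 'r \<Rightarrow> real ^ 'm \<Rightarrow> real ^ 'r ^ 'r" where
  "info_post_cov \<Sigma> C M lam =
     M ** \<Sigma> ** transpose M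
     - M ** \<Sigma> ** transpose C ** sensor_weight (C ** \<Sigma> ** transpose C) lam ** C ** \<Sigma> ** transpose M"

lemma psd_innovation: "psd \<Sigma> \<Longrightarrow> psd (C ** \<Sigma> ** transpose C)"
  using psd_congruence[of \<Sigma> "transpose C"] by simp

lemma post_cov_eq_info_post_cov:
  assumes \<Sigma>: "psd \<Sigma>" and lam: "0 \<le> lam"
  shows "post_cov \<Sigma> C M lam = info_post_cov \<Sigma> C M lam"
proof -
  note T = psd_innovation[OF \<Sigma>, of C]
  have pos: "post_cov_pos \<Sigma> C M l = info_post_cov \<Sigma> C M l" if "\<And>i. 0 < l $ i" for l
    by (simp add: post_cov_pos_def info_post_cov_def sensor_weight_eq_inverse[OF T that])
  have "((\<lambda>e. info_post_cov \<Sigma> C M (\<chi> i. lam $ i + e)) \<longlongrightarrow> info_post_cov \<Sigma> C M lam) (at_right 0)"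
    unfolding info_post_cov_def
    by (intro tendsto_diff tendsto_matrix_mult tendsto_const tendsto_sensor_weight T lam)
  moreover have "\<forall>\<^sub>F e in at_right 0. info_post_cov \<Sigma> C M (\<chi> i. lam $ i + e)
      = post_cov_pos \<Sigma> C M (\<chi> i. lam $ i + e)"
    using eventually_at_right_less[of "0 :: real"]
  proof (rule eventually_mono)
    fix e :: real assume "0 < e"
    then have "0 < (\<chi> i. lam $ i + e) $ i" for i
      using lam by (simp add: less_eq_vec_def add_nonneg_pos)
    then show "info_post_cov \<Sigma> C M (\<chi> i. lam $ i + e) = post_cov_pos \<Sigma> C M (\<chi> i. lam $ i + e)"
      by (rule pos[symmetric])
  qed
  ultimately have "((\<lambda>e. post_cov_pos \<Sigma> C M (\<chi> i. lam $ i + e)) \<longlongrightarrow> info_post_cov \<Sigma> C M lam)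
      (at_right 0)"
    by (rule Lim_transform_eventually)
  then have "Lim (at_right 0) (\<lambda>e. post_cov_pos \<Sigma> C M (\<chi> i. lam $ i + e)) = info_post_cov \<Sigma> C M lam"
    by (intro tendsto_Lim) simp_all
  then show ?thesis by (simp add: post_cov_def pos)
qed

lemma transpose_info_post_cov:
  assumes \<Sigma>: "psd \<Sigma>" and lam: "0 \<le> lam"
  shows "transpose (info_post_cov \<Sigma> C M lam) = info_post_cov \<Sigma> C M lam"
  by (simp only: info_post_cov_def transpose_diff matrix_transpose_mul transpose_transpose
      transpose_sensor_weight[OF psd_innovation[OF \<Sigma>] lam] psd_symmetric[OF \<Sigma>] matrix_mul_assoc)

text \<open>For the Kalman gain \<open>K\<close>, \<open>diag lam *v h\<close> is
  \<open>transpose K\<close> applied to \<open>transpose M *v x\<close>, and \<open>v\<close> is the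
  matching vector for \<open>transpose (mat 1 - K ** C)\<close>. The last identity splits the
  posterior variance into a prior part and a sensor noise part.\<close>

lemma info_post_cov_form:
  fixes \<Sigma> :: "real ^ 'n ^ 'n" and C :: "real ^ 'n ^ 'm" and M :: "real ^ 'n ^ 'r"
  assumes \<Sigma>: "psd \<Sigma>" and lam: "0 \<le> lam"
  obtains h v where
    "v = transpose M *v x - transpose C *v (diag lam *v h)"
    "h = C *v (\<Sigma> *v v)"
    "diag lam *v h = sensor_weight (C ** \<Sigma> ** transpose C) lam *v (C *v (\<Sigma> *v (transpose M *v x)))"
    "x \<bullet> (info_post_cov \<Sigma> C M lam *v x) = (transpose M *v x) \<bullet> (\<Sigma> *v v)"
    "x \<bullet> (info_post_cov \<Sigma> C M lam *v x) = v \<bullet> (\<Sigma> *v v) + h \<bullet> (diag lam *v h)"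
proof -
  let ?T = "C ** \<Sigma> ** transpose C" and ?L = "diag lam"
  define w where "w = transpose M *v x"
  define h where "h = matrix_inv (mat 1 + ?T ** ?L) *v (C *v (\<Sigma> *v w))"
  define v where "v = w - transpose C *v (?L *v h)"
  note inv = matrix_inv_right_inverse[OF invertible_sensor[OF psd_innovation[OF \<Sigma>] lam]]
  have "(mat 1 + ?T ** ?L) *v h = C *v (\<Sigma> *v w)"
    unfolding h_def by (simp add: matrix_vector_mul_assoc inv matrix_mul_assoc)
  then have "h + C *v (\<Sigma> *v (transpose C *v (?L *v h))) = C *v (\<Sigma> *v w)"
    by (simp only: matrix_vector_mult_add_rdistrib matrix_vector_mul_lid matrix_vector_mul_assoc
        matrix_mul_assoc)
  then have h: "h = C *v (\<Sigma> *v v)"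
    by (simp only: v_def matrix_vector_mult_diff_distrib) (metis add_diff_cancel_right')
  have Lh: "?L *v h = sensor_weight ?T lam *v (C *v (\<Sigma> *v w))"
    by (simp only: h_def sensor_weight_def matrix_vector_mul_assoc matrix_mul_assoc)
  have "info_post_cov \<Sigma> C M lam *v x = M *v (\<Sigma> *v w) - M *v (\<Sigma> *v (transpose C *v (?L *v h)))"
    unfolding Lh
    by (simp only: info_post_cov_def w_def matrix_vector_mult_diff_rdistrib matrix_vector_mul_assoc
        matrix_mul_assoc)
  then have "info_post_cov \<Sigma> C M lam *v x = M *v (\<Sigma> *v v)"
    by (simp only: v_def matrix_vector_mult_diff_distrib)
  then have P: "x \<bullet> (info_post_cov \<Sigma> C M lam *v x) = w \<bullet> (\<Sigma> *v v)"
    by (simp only: w_def transpose_vector_inner)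
  \<comment> \<open>The split follows by pairing \<open>w = v + transpose C *v (?L *v h)\<close>
    with \<open>\<Sigma> *v v\<close> and using \<open>h = C *v (\<Sigma> *v v)\<close>.\<close>
  have "(transpose C *v (?L *v h)) \<bullet> (\<Sigma> *v v) = (?L *v h) \<bullet> (C *v (\<Sigma> *v v))"
    by (simp only: transpose_vector_inner)
  then have "w \<bullet> (\<Sigma> *v v) = v \<bullet> (\<Sigma> *v v) + h \<bullet> (?L *v h)"
    by (simp only: h[symmetric]) (simp add: v_def inner_diff_left inner_commute del: transpose_matrix_vector)
  then show ?thesis using that[of v h] h Lh P unfolding v_def w_def by simp
qed

section \<open>Feasible points\<close>

lemma info_post_cov_le_of_feasible:
  assumes \<Sigma>: "psd \<Sigma>" and f: "feasible \<Sigma> C M \<gamma> (lam, Q, K)"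
  shows "x \<bullet> (info_post_cov \<Sigma> C M lam *v x) \<le> x \<bullet> (Q *v x)"
proof -
  have lam: "0 \<le> lam" and Q: "psd Q" and lmi: "psd (lmi_matrix \<Sigma> C M lam Q K)"
    using f by (auto simp: feasible_def)
  obtain h v where v: "v = transpose M *v x - transpose C *v (diag lam *v h)"
    and h: "h = C *v (\<Sigma> *v v)"
    and P1: "x \<bullet> (info_post_cov \<Sigma> C M lam *v x) = (transpose M *v x) \<bullet> (\<Sigma> *v v)"
    and P2: "x \<bullet> (info_post_cov \<Sigma> C M lam *v x) = v \<bullet> (\<Sigma> *v v) + h \<bullet> (diag lam *v h)"
    using info_post_cov_form[OF \<Sigma> lam] .
  define S where "S = psd_sqrt \<Sigma>"
  define w where "w = transpose M *v x"
  define k where "k = transpose K *v w"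
  have S: "psd S" "S ** S = \<Sigma>" unfolding S_def by (rule psd_sqrt[OF \<Sigma>])+
  have SS: "(S *v a) \<bullet> (S *v b) = a \<bullet> (\<Sigma> *v b)" for a b
    by (metis S matrix_vector_mul_assoc psd_inner)
  \<comment> \<open>The test vector \<open>(x, - S v, - h)\<close> is where both squares vanish in
    the completed form for the Kalman gain.\<close>
  have "0 \<le> x \<bullet> (Q *v x) + 2 * ((S *v (w - transpose C *v k)) \<bullet> (- (S *v v))) + 2 * (k \<bullet> (- h))
      + (- (S *v v)) \<bullet> (- (S *v v)) + (- h) \<bullet> (diag lam *v (- h))"
    using lmi[unfolded psd_lmi_matrix_iff[OF \<Sigma> psd_symmetric[OF Q]]]
    unfolding S_def w_def k_def by blast
  also have "diag lam *v (- h) = - (diag lam *v h)"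
    by (simp add: diag_mult vec_eq_iff)
  \<comment> \<open>The gain enters only through \<open>k\<close>, and this
    \<open>k \<bullet> h\<close> cancels against the term from \<open>- h\<close>. What is left is
    the form of \<open>Q\<close> minus twice the posterior variance plus once the posterior
    variance.\<close>
  also have "(S *v (w - transpose C *v k)) \<bullet> (- (S *v v)) = k \<bullet> h - w \<bullet> (\<Sigma> *v v)"
  proof -
    have "(transpose C *v k) \<bullet> (\<Sigma> *v v) = k \<bullet> h"
      by (metis h transpose_vector_inner)
    then show ?thesis by (simp add: SS inner_diff_left del: transpose_matrix_vector)
  qed
  finally show ?thesis
    using P1 P2 by (simp add: SS w_def[symmetric] del: transpose_matrix_vector)
qed

text \<open>The witness for the gain is the Kalman gain, written as a transpose because the form
  involves only \<open>transpose K\<close>.\<close>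

lemma feasible_info_post_cov:
  assumes \<Sigma>: "psd \<Sigma>" and lam: "0 \<le> lam" and tr: "trace (info_post_cov \<Sigma> C M lam) \<le> \<gamma>"
  shows "feasible \<Sigma> C M \<gamma> (lam, info_post_cov \<Sigma> C M lam,
    transpose (sensor_weight (C ** \<Sigma> ** transpose C) lam ** C ** \<Sigma>))"
    (is "feasible _ _ _ _ (lam, ?P, ?K)")
proof -
  define S where "S = psd_sqrt \<Sigma>"
  have S: "psd S" "S ** S = \<Sigma>" unfolding S_def by (rule psd_sqrt[OF \<Sigma>])+
  note L = psd_diag[OF lam]
  have K: "transpose ?K *v w = sensor_weight (C ** \<Sigma> ** transpose C) lam *v (C *v (\<Sigma> *v w))" for w
    by (simp only: transpose_transpose matrix_vector_mul_assoc matrix_mul_assoc)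
  note sym = transpose_info_post_cov[OF \<Sigma> lam, of C M]
  have "0 \<le> x \<bullet> (?P *v x)" for x
  proof -
    obtain h v where "x \<bullet> (?P *v x) = v \<bullet> (\<Sigma> *v v) + h \<bullet> (diag lam *v h)"
      using info_post_cov_form[OF \<Sigma> lam] .
    then show ?thesis using psd_nonneg[OF \<Sigma>, of v] psd_nonneg[OF L, of h] by simp
  qed
  then have "psd ?P" using sym by (simp add: psd_def)
  moreover have "psd (lmi_matrix \<Sigma> C M lam ?P ?K)"
    unfolding psd_lmi_matrix_iff[OF \<Sigma> sym]
  proof (intro allI)
    fix x y z
    obtain h v where v: "v = transpose M *v x - transpose C *v (diag lam *v h)"
      and Lh: "diag lam *v h = sensor_weight (C ** \<Sigma> ** transpose C) lam *v (C *v (\<Sigma> *v (transpose M *v x)))"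
      and P: "x \<bullet> (?P *v x) = v \<bullet> (\<Sigma> *v v) + h \<bullet> (diag lam *v h)"
      using info_post_cov_form[OF \<Sigma> lam] .
    have SS: "v \<bullet> (\<Sigma> *v v) = (S *v v) \<bullet> (S *v v)"
      by (metis S matrix_vector_mul_assoc psd_inner)
    \<comment> \<open>Completing squares: the leftover constant
      \<open>v \<bullet> (\<Sigma> *v v) + h \<bullet> (diag lam *v h)\<close> is exactly the form
      of the posterior covariance at \<open>x\<close>.\<close>
    have "0 \<le> (S *v v + y) \<bullet> (S *v v + y) + (h + z) \<bullet> (diag lam *v (h + z))"
      by (intro add_nonneg_nonneg psd_nonneg[OF L] inner_ge_zero)
    also have "\<dots> = x \<bullet> (?P *v x) + 2 * ((S *v v) \<bullet> y) + 2 * ((diag lam *v h) \<bullet> z)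
        + y \<bullet> y + z \<bullet> (diag lam *v z)"
      using psd_inner[OF L, of h z]
      by (simp add: P SS inner_add_left inner_add_right matrix_vector_right_distrib inner_commute)
    finally show "0 \<le> x \<bullet> (?P *v x)
        + 2 * ((psd_sqrt \<Sigma> *v (transpose M *v x - transpose C *v (transpose ?K *v (transpose M *v x)))) \<bullet> y)
        + 2 * ((transpose ?K *v (transpose M *v x)) \<bullet> z) + y \<bullet> y + z \<bullet> (diag lam *v z)"
      by (simp only: K Lh[symmetric] v[symmetric] S_def)
  qed
  ultimately show ?thesis using lam tr by (simp add: feasible_def)
qed

section \<open>Optimal points and minimal sensing precision\<close>

theorem corollary1:
  fixes \<Sigma> :: "real ^ 'n ^ 'n"
    and C :: "real ^ 'n ^ 'm"
    and M :: "real ^ 'n ^ 'r"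
    and \<gamma> :: real
    and lam :: "real ^ 'm"
    and Q :: "real ^ 'r ^ 'r"
    and K :: "real ^ 'm ^ 'n"
  assumes "psd \<Sigma>"
    and "is_arg_min (\<lambda>(lam, Q, K). l1_norm lam) (feasible \<Sigma> C M \<gamma>) (lam, Q, K)"
  shows "trace (post_cov \<Sigma> C M lam) \<le> \<gamma> \<and>
         (\<forall>lam'. 0 \<le> lam' \<and> trace (post_cov \<Sigma> C M lam') \<le> \<gamma> \<longrightarrow> l1_norm lam \<le> l1_norm lam')"
proof (intro conjI allI impI)
  have f: "feasible \<Sigma> C M \<gamma> (lam, Q, K)"
    and opt: "\<And>lam' Q' K'. feasible \<Sigma> C M \<gamma> (lam', Q', K') \<Longrightarrow> l1_norm lam \<le> l1_norm lam'"
    using assms(2) by (force simp: is_arg_min_def not_less)+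
  then have lam: "0 \<le> lam" and Q: "trace Q \<le> \<gamma>" by (auto simp: feasible_def)
  have "0 \<le> trace (Q - info_post_cov \<Sigma> C M lam)"
    using info_post_cov_le_of_feasible[OF assms(1) f]
    by (intro trace_psd_nonneg) (simp add: matrix_vector_mult_diff_rdistrib inner_diff_right)
  then show "trace (post_cov \<Sigma> C M lam) \<le> \<gamma>"
    using Q by (simp add: trace_sub post_cov_eq_info_post_cov[OF assms(1) lam])
  fix lam' :: "real ^ 'm"
  assume "0 \<le> lam' \<and> trace (post_cov \<Sigma> C M lam') \<le> \<gamma>"
  \<comment> \<open>Any admissible \<open>lam'\<close> extends to a feasible triple with its own
    posterior covariance and Kalman gain, so optimality applies to it.\<close>
  then show "l1_norm lam \<le> l1_norm lam'"
    using feasible_info_post_cov[OF assms(1)] post_cov_eq_info_post_cov[OF assms(1)] opt by metis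
qed

end
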